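(* Let $G$ be an abelian group which is free of 2-torsion, $g_0\in G$, and let $\mathcal P=\bigoplus_{g\in G}\mathcal P_g$ be a Poisson color algebra of degree $g_0$ over a field $\mathbb K$, with restricted support $\Sigma$ and connection relation $\sim$ on $\Sigma$. Suppose that $\mathcal P_\alpha$ is tight for every $\alpha\in\{0,g_0,-g_0\}$. Then $$\mathcal P=\sum_{[g]\in\Sigma/\sim}\mathcal I_{[g]},$$ where each $\mathcal I_{[g]}$ is an ideal of $\mathcal P$. Moreover, $\{\mathcal I_{[g]},\mathcal I_{[h]}\}+\mathcal I_{[g]}\mathcal I_{[h]}=0$ whenever $[g]\neq[h]$.
   Context: $\mathbb K$ is an arbitrary field, $(G,+)$ an abelian group; all algebras have arbitrary dimension. "Free of 2-torsion" means $2x=0$ implies $x=0$ in $G$. A skew-symmetric bicharacter of $G$ is a map $\epsilon:G\times G\to\mathbb K\setminus\{0\}$ with $\epsilon(a,b)=\epsilon(b,a)^{-1}$ and $\epsilon(a,b+c)=\epsilon(a,b)\epsilon(a,c)$. Poisson color algebra of degree $g_0\in G$ (with respect to $\epsilon$): a $G$-graded $\mathbb K$-vector space $\mathcal P=\bigoplus_{g\in G}\mathcal P_g$ with a bilinear product $\{\cdot,\cdot\}$ satisfying $\{\mathcal P_g,\mathcal P_h\}\subset\mathcal P_{g+h+g_0}$ and, for homogeneous $x,y,z$ of degrees $|x|,|y|,|z|$, $\{x,y\}=-\epsilon(|x|+g_0,|y|+g_0)\{y,x\}$ and $\{x,\{y,z\}\}=\{\{x,y\},z\}+\epsilon(|x|+g_0,|y|+g_0)\{y,\{x,z\}\}$;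 together with a bilinear associative product (juxtaposition) satisfying $\mathcal P_g\mathcal P_h\subset\mathcal P_{g+h}$, $xy=\epsilon(|x|,|y|)yx$ and $\{x,yz\}=\{x,y\}z+\epsilon(|x|+g_0,|y|)y\{x,z\}$ for homogeneous $x,y,z$. Products $\{A,B\}$ and $AB$ of subspaces denote linear spans of products of elements. A subalgebra is a graded linear subspace $\mathcal Q$ with $\{\mathcal Q,\mathcal Q\}+\mathcal Q\mathcal Q\subset\mathcal Q$; an ideal is a subalgebra $\mathcal I$ (in particular graded) with $\{\mathcal I,\mathcal P\}+\{\mathcal P,\mathcal I\}+\mathcal I\mathcal P+\mathcal P\mathcal I\subset\mathcal I$. Restricted support: $\Sigma=\{g\in G:\mathcal P_g\neq0\}\setminus\{0,\pm g_0\}$; $-\Sigma=\{-g:g\in\Sigma\}$, $\pm\Sigma=\Sigma\cup(-\Sigma)$. Connection: for $g,h\in\Sigma$, $g$ is connected to $h$ if there exist $n\ge1$, $g_1,\dots,g_n\in\pm\Sigma\cup\{0,\pm g_0\}$ and $k_2,\dots,k_n\in\{0,\pm g_0\}$ such that $g_1=g$; for each $2\le m\le n-1$, $g_1+(g_2+k_2)+\cdots+(g_m+k_m)\in\pm\Sigma$; and $g_1+(g_2+k_2)+\cdots+(g_n+k_n)\in\{h,-h\}$. The relation $g\sim h$ iff $g$ is connected to $h$ is an equivalence relation on $\Sigma$; $[g]$ is the class of $g$. For $g\in\Sigma$ and $\alpha\in\{0,g_0,-g_0\}$ put $$\mathcal P_{\alpha,[g]}=\sum_{\substack{h\in[g],\,p\in\Sigma\\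 p=-h-g_0+\alpha}}\{\mathcal P_h,\mathcal P_p\}+\sum_{\substack{k\in[g],\,q\in\Sigma\cup\{-g_0\}\\ q=-k+\alpha}}\mathcal P_k\mathcal P_q\subset\mathcal P_\alpha,$$ $\mathcal V_{[g]}=\bigoplus_{h\in[g]}\mathcal P_h$, and $\mathcal I_{[g]}=\Big(\sum_{\alpha\in\{0,g_0,-g_0\}}\mathcal P_{\alpha,[g]}\Big)\oplus\mathcal V_{[g]}$. Tightness: for $\alpha\in\{\pm ng_0:n=0,1,2,3\}$, $\mathcal P_\alpha$ is tight if, with $\Sigma'=\Sigma\setminus\{\pm2g_0,\pm3g_0\}$, $$\mathcal P_\alpha=\sum_{\substack{h,p\in\Sigma'\\ p=-h-g_0+\alpha}}\{\mathcal P_h,\mathcal P_p\}+\sum_{\substack{k,q\in\Sigma'\\ q=-k+\alpha}}\mathcal P_k\mathcal P_q.$$ *)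

theory Defs
  imports Complex_Main "HOL-Library.Set_Algebras"
begin

text \<open>
  The algebra is the whole type \<open>'v\<close>, a vector space over \<open>'k\<close> through \<open>scale\<close>; \<open>P g\<close> is the
  homogeneous component of degree \<open>g\<close>. The sum of two subspaces is written with \<open>+\<close> (setwise
  addition), the sum of a family of subspaces is the span of its union.
\<close>

definition skew_bicharacter :: "('g::ab_group_add \<Rightarrow> 'g \<Rightarrow> 'k::field) \<Rightarrow> bool" where
  "skew_bicharacter eps \<longleftrightarrow>
     (\<forall>a b. eps a b \<noteq> 0) \<and>
     (\<forall>a b. eps a b = inverse (eps b a)) \<and>
     (\<forall>a b c. eps a (b + c) = eps a b * eps a c)"

locale poisson_color_algebra = vector_space scale
  for scale :: "'k::field \<Rightarrow> 'v::ab_group_add \<Rightarrow> 'v" +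
  fixes eps :: "'g::ab_group_add \<Rightarrow> 'g \<Rightarrow> 'k"
    and g0 :: 'g
    and P :: "'g \<Rightarrow> 'v set"
    and brk :: "'v \<Rightarrow> 'v \<Rightarrow> 'v"
    and mul :: "'v \<Rightarrow> 'v \<Rightarrow> 'v"
  assumes bichar: "skew_bicharacter eps"
    and comp_subspace: "subspace (P g)"
    and grading: "\<exists>!f. (\<forall>g. f g \<in> P g) \<and> finite {g. f g \<noteq> 0} \<and> x = (\<Sum>g | f g \<noteq> 0. f g)"
    and brk_linear_right: "Vector_Spaces.linear scale scale (\<lambda>y. brk x y)"
    and brk_linear_left: "Vector_Spaces.linear scale scale (\<lambda>x. brk x y)"
    and brk_degree: "x \<in> P a \<Longrightarrow> y \<in> P b \<Longrightarrow> brk x y \<in> P (a + b + g0)"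
    and brk_skew: "x \<in> P a \<Longrightarrow> y \<in> P b \<Longrightarrow>
          brk x y = - scale (eps (a + g0) (b + g0)) (brk y x)"
    and brk_jacobi: "x \<in> P a \<Longrightarrow> y \<in> P b \<Longrightarrow> z \<in> P c \<Longrightarrow>
          brk x (brk y z) = brk (brk x y) z + scale (eps (a + g0) (b + g0)) (brk y (brk x z))"
    and mul_linear_right: "Vector_Spaces.linear scale scale (\<lambda>y. mul x y)"
    and mul_linear_left: "Vector_Spaces.linear scale scale (\<lambda>x. mul x y)"
    and mul_assoc: "mul (mul x y) z = mul x (mul y z)"
    and mul_degree: "x \<in> P a \<Longrightarrow> y \<in> P b \<Longrightarrow> mul x y \<in> P (a + b)"
    and mul_comm: "x \<in> P a \<Longrightarrow> y \<in> P b \<Longrightarrow> mul x y = scale (eps a b) (mul y x)"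
    and leibniz: "x \<in> P a \<Longrightarrow> y \<in> P b \<Longrightarrow> z \<in> P c \<Longrightarrow>
          brk x (mul y z) = mul (brk x y) z + scale (eps (a + g0) b) (mul y (brk x z))"
begin

definition brk_span :: "'v set \<Rightarrow> 'v set \<Rightarrow> 'v set" where
  "brk_span A B = span {brk a b | a b. a \<in> A \<and> b \<in> B}"

definition mul_span :: "'v set \<Rightarrow> 'v set \<Rightarrow> 'v set" where
  "mul_span A B = span {mul a b | a b. a \<in> A \<and> b \<in> B}"

definition graded_subspace :: "'v set \<Rightarrow> bool" where
  "graded_subspace Q \<longleftrightarrow> subspace Q \<and> Q = span (\<Union>g. Q \<inter> P g)"

definition subalgebra :: "'v set \<Rightarrow> bool" where
  "subalgebra Q \<longleftrightarrow> graded_subspace Q \<and> brk_span Q Q + mul_span Q Q \<subseteq> Q"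

definition is_ideal :: "'v set \<Rightarrow> bool" where
  "is_ideal I \<longleftrightarrow> subalgebra I \<and>
     brk_span I UNIV + brk_span UNIV I + mul_span I UNIV + mul_span UNIV I \<subseteq> I"

definition rsupp :: "'g set" where
  "rsupp = {g. P g \<noteq> {0}} - {0, g0, - g0}"

definition pm_rsupp :: "'g set" where
  "pm_rsupp = rsupp \<union> uminus ` rsupp"

definition connected :: "'g \<Rightarrow> 'g \<Rightarrow> bool" where
  "connected g h \<longleftrightarrow>
     (\<exists>(n::nat) (s :: nat \<Rightarrow> 'g) (k :: nat \<Rightarrow> 'g).
        n \<ge> 1 \<and>
        (\<forall>i\<in>{1..n}. s i \<in> pm_rsupp \<union> {0, g0, - g0}) \<and>
        (\<forall>i\<in>{2..n}. k i \<in> {0, g0, - g0}) \<and>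
        s 1 = g \<and>
        (\<forall>m. 2 \<le> m \<and> m \<le> n - 1 \<longrightarrow> s 1 + (\<Sum>i=2..m. s i + k i) \<in> pm_rsupp) \<and>
        s 1 + (\<Sum>i=2..n. s i + k i) \<in> {h, - h})"

definition conn_rel :: "('g \<times> 'g) set" where
  "conn_rel = {(g, h). g \<in> rsupp \<and> h \<in> rsupp \<and> connected g h}"

text \<open>In the following three definitions, \<open>C\<close> stands for a class in \<open>rsupp // conn_rel\<close>.\<close>

definition class_part :: "'g \<Rightarrow> 'g set \<Rightarrow> 'v set" where
  "class_part \<alpha> C =
     span (\<Union>{brk_span (P h) (P p) | h p. h \<in> C \<and> p \<in> rsupp \<and> p = - h - g0 + \<alpha>}) +
     span (\<Union>{mul_span (P k) (P q) | k q. k \<in> C \<and> q \<in> rsupp \<union> {- g0} \<and> q = - k + \<alpha>})"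

definition class_space :: "'g set \<Rightarrow> 'v set" where
  "class_space C = span (\<Union>h\<in>C. P h)"

text \<open>
  The last sum is direct for \<open>C \<subseteq> rsupp\<close>: its left summand lies in components whose degrees
  \<open>0\<close>, \<open>g0\<close>, \<open>- g0\<close> are not in \<open>rsupp\<close>.
\<close>

definition class_ideal :: "'g set \<Rightarrow> 'v set" where
  "class_ideal C = span (\<Union>\<alpha>\<in>{0, g0, - g0}. class_part \<alpha> C) + class_space C"

definition rsupp' :: "'g set" where
  "rsupp' = rsupp - {g0 + g0, - (g0 + g0), g0 + g0 + g0, - (g0 + g0 + g0)}"

definition tight :: "'g \<Rightarrow> bool" where
  "tight \<alpha> \<longleftrightarrow> P \<alpha> =
     span (\<Union>{brk_span (P h) (P p) | h p. h \<in> rsupp' \<and> p \<in> rsupp' \<and> p = - h - g0 + \<alpha>}) +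
     span (\<Union>{mul_span (P k) (P q) | k q. k \<in> rsupp' \<and> q \<in> rsupp' \<and> q = - k + \<alpha>})"

end

end

theory Submission
  imports Defs
begin

text \<open>
  For a class \<open>C\<close> let \<open>W\<close> be the set of homogeneous elements with degree in \<open>C\<close>, and let \<open>J\<close> be the
  span of \<open>W\<close>, \<open>{W, W}\<close> and \<open>W W\<close>. Elements of \<open>W\<close> for different classes annihilate each other,
  because a nonzero product would connect their degrees; by the Jacobi and Leibniz identities so do
  the corresponding spaces \<open>J\<close>. The key point is that all products of \<open>W\<close> with the whole algebra
  lie in \<open>J\<close>. This is clear unless one factor and the product both have degree in
  \<open>{0, g0, - g0}\<close>; in that case tightness expands the factor into products of elements \<open>a\<close>, \<open>b\<close>
  with degrees in \<open>rsupp'\<close>, and the degrees removed in \<open>rsupp'\<close> are exactly those that could bring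
  a product of \<open>a\<close> or \<open>b\<close> with \<open>W\<close> back to degree \<open>0\<close> or \<open>\<plusminus>g0\<close>. The Jacobi and Leibniz identities
  then make \<open>J\<close> an ideal, and \<open>J\<close> is the space \<open>class_ideal C\<close>.
\<close>

context poisson_color_algebra
begin

section \<open>Connections as walks in a graph on \<open>pm_rsupp\<close>\<close>

text \<open>A walk along these edges runs through the partial sums of a connection. Both ends must
  lie in \<open>pm_rsupp\<close> so that every move can be reversed.\<close>

definition step :: "'g \<Rightarrow> 'g \<Rightarrow> bool" where
  "step a b \<longleftrightarrow> a \<in> pm_rsupp \<and> b \<in> pm_rsupp \<and>
     (\<exists>t\<in>pm_rsupp \<union> {0, g0, - g0}. \<exists>k\<in>{0, g0, - g0}. b = a + (t + k))"

lemma uminus_pm_rsupp: "a \<in> pm_rsupp \<Longrightarrow> - a \<in> pm_rsupp"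
  by (auto simp: pm_rsupp_def)

lemma rsupp_pm_rsupp: "a \<in> rsupp \<Longrightarrow> a \<in> pm_rsupp"
  by (auto simp: pm_rsupp_def)

lemma uminus_special: "k \<in> {0, g0, - g0} \<Longrightarrow> - k \<in> {0, g0, - g0}"
  by auto

lemma uminus_pm_rsupp_special:
  "t \<in> pm_rsupp \<union> {0, g0, - g0} \<Longrightarrow> - t \<in> pm_rsupp \<union> {0, g0, - g0}"
  using uminus_pm_rsupp uminus_special by blast

lemma stepI:
  "a \<in> pm_rsupp \<Longrightarrow> b \<in> pm_rsupp \<Longrightarrow> t \<in> pm_rsupp \<union> {0, g0, - g0} \<Longrightarrow> k \<in> {0, g0, - g0}
    \<Longrightarrow> b = a + (t + k) \<Longrightarrow> step a b"
  unfolding step_def by blast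

lemma stepE:
  assumes "step a b"
  obtains t k where "a \<in> pm_rsupp" "b \<in> pm_rsupp" "t \<in> pm_rsupp \<union> {0, g0, - g0}"
    "k \<in> {0, g0, - g0}" "b = a + (t + k)"
  using assms unfolding step_def by blast

lemma step_uminus:
  assumes "step a b"
  shows "step (- a) (- b)"
proof -
  obtain t k where *: "a \<in> pm_rsupp" "b \<in> pm_rsupp" "t \<in> pm_rsupp \<union> {0, g0, - g0}"
    "k \<in> {0, g0, - g0}" "b = a + (t + k)"
    using assms by (rule stepE)
  have "- b = - a + (- t + - k)"
    unfolding *(5) by simp
  then show ?thesis
    using *(1-4) by (intro stepI[of _ _ "- t" "- k"] uminus_pm_rsupp uminus_pm_rsupp_special uminus_special)
qed

lemma step_sym:
  assumes "step a b"
  shows "step b a"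
proof -
  obtain t k where *: "a \<in> pm_rsupp" "b \<in> pm_rsupp" "t \<in> pm_rsupp \<union> {0, g0, - g0}"
    "k \<in> {0, g0, - g0}" "b = a + (t + k)"
    using assms by (rule stepE)
  have "a = b + (- t + - k)"
    unfolding *(5) by simp
  then show ?thesis
    using *(1-4) by (intro stepI[of _ _ "- t" "- k"] uminus_pm_rsupp_special uminus_special)
qed

lemma steps_uminus: "step\<^sup>*\<^sup>* a b \<Longrightarrow> step\<^sup>*\<^sup>* (- a) (- b)"
  by (induction rule: rtranclp_induct) (auto intro: rtranclp.rtrancl_into_rtrancl step_uminus)

lemma steps_sym: "step\<^sup>*\<^sup>* a b \<Longrightarrow> step\<^sup>*\<^sup>* b a"
  by (induction rule: rtranclp_induct) (auto intro: converse_rtranclp_into_rtranclp step_sym)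

text \<open>Each move appends one increment to the chain. Unlike in \<open>connected\<close>, the
  partial sum at \<open>m = n\<close> is part of the claim, since the old end becomes an interior
  point of the longer chain.\<close>

lemma steps_imp_path:
  assumes "step\<^sup>*\<^sup>* a b" "a \<in> pm_rsupp"
  shows "\<exists>(n::nat) s k. n \<ge> 1 \<and> (\<forall>i\<in>{1..n}. s i \<in> pm_rsupp \<union> {0, g0, - g0}) \<and>
     (\<forall>i\<in>{2..n}. k i \<in> {0, g0, - g0}) \<and> s 1 = a \<and>
     (\<forall>m. 2 \<le> m \<and> m \<le> n \<longrightarrow> s 1 + (\<Sum>i=2..m. s i + k i) \<in> pm_rsupp) \<and>
     s 1 + (\<Sum>i=2..n. s i + k i) = b"
  using assms(1)
proof (induction rule: rtranclp_induct)
  case base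
  \<comment> \<open>A chain of length 1 has an empty sum, so the value 0 for \<open>k\<close> is an
    arbitrary default.\<close>
  show ?case
    by (rule exI[of _ 1], rule exI[of _ "\<lambda>_. a"], rule exI[of _ "\<lambda>_. 0"]) (use assms in auto)
next
  case (step b c)
  from step.IH obtain n :: nat and s k where *: "n \<ge> 1"
     "\<forall>i\<in>{1..n}. s i \<in> pm_rsupp \<union> {0, g0, - g0}"
     "\<forall>i\<in>{2..n}. k i \<in> {0, g0, - g0}" "s 1 = a"
     "\<forall>m. 2 \<le> m \<and> m \<le> n \<longrightarrow> s 1 + (\<Sum>i=2..m. s i + k i) \<in> pm_rsupp"
     "s 1 + (\<Sum>i=2..n. s i + k i) = b"
    by blast
  obtain t l where tl: "c \<in> pm_rsupp" "t \<in> pm_rsupp \<union> {0, g0, - g0}"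
    "l \<in> {0, g0, - g0}" "c = b + (t + l)"
    using step.hyps(2) by (rule stepE)
  define s' where "s' = s(Suc n := t)"
  define k' where "k' = k(Suc n := l)"
  have sum_eq: "(\<Sum>i=2..m. s' i + k' i) = (\<Sum>i=2..m. s i + k i)" if "m \<le> n" for m
    using that by (intro sum.cong) (auto simp: s'_def k'_def)
  have s1: "s' 1 = s 1"
    using * by (auto simp: s'_def)
  have last: "s' 1 + (\<Sum>i=2..Suc n. s' i + k' i) = c"
  proof -
    have "(\<Sum>i=2..Suc n. s' i + k' i) = (\<Sum>i=2..n. s i + k i) + (t + l)"
      using * sum_eq[of n] by (simp add: s'_def k'_def)
    then show ?thesis
      unfolding s1 using * tl by (simp add: add.assoc)
  qed
  have "s' 1 + (\<Sum>i=2..m. s' i + k' i) \<in> pm_rsupp" if "2 \<le> m" "m \<le> Suc n" for m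
  proof (cases "m = Suc n")
    case True
    then show ?thesis using last tl by simp
  next
    case False
    then show ?thesis using that * sum_eq[of m] s1 by auto
  qed
  moreover have "\<forall>i\<in>{1..Suc n}. s' i \<in> pm_rsupp \<union> {0, g0, - g0}"
    using *(2) tl(2) by (simp add: s'_def atLeastAtMostSuc_conv)
  moreover have "\<forall>i\<in>{2..Suc n}. k' i \<in> {0, g0, - g0}"
    using *(1,3) tl(3) by (simp add: k'_def atLeastAtMostSuc_conv)
  ultimately show ?case
    using *(4) last s1 by (intro exI[of _ "Suc n"] exI[of _ s'] exI[of _ k'] conjI) auto
qed

lemma connected_iff_steps:
  assumes "g \<in> rsupp" "h \<in> rsupp"
  shows "connected g h \<longleftrightarrow> step\<^sup>*\<^sup>* g h \<or> step\<^sup>*\<^sup>* g (- h)"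
proof
  assume "connected g h"
  then obtain n :: nat and s k where *: "n \<ge> 1"
     "\<forall>i\<in>{1..n}. s i \<in> pm_rsupp \<union> {0, g0, - g0}"
     "\<forall>i\<in>{2..n}. k i \<in> {0, g0, - g0}" "s 1 = g"
     "\<forall>m. 2 \<le> m \<and> m \<le> n - 1 \<longrightarrow> s 1 + (\<Sum>i=2..m. s i + k i) \<in> pm_rsupp"
     "s 1 + (\<Sum>i=2..n. s i + k i) \<in> {h, - h}"
    unfolding connected_def by blast
  define f where "f m = s 1 + (\<Sum>i=2..m. s i + k i)" for m
  have f1: "f 1 = g"
    using * by (simp add: f_def)
  have fn: "f n \<in> {h, - h}"
    using * by (simp add: f_def)
  \<comment> \<open>\<open>connected\<close> controls only the partial sums with 2 \<le> m \<le> n -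
    1; the two ends are in \<open>pm_rsupp\<close> because \<open>g\<close> and \<open>h\<close> are
    in \<open>rsupp\<close>.\<close>
  have f_pm: "f m \<in> pm_rsupp" if "1 \<le> m" "m \<le> n" for m
  proof -
    have "m = 1 \<or> m = n \<or> 2 \<le> m \<and> m \<le> n - 1"
      using that by linarith
    then consider "m = 1" | "m = n" | "2 \<le> m" "m \<le> n - 1"
      by blast
    then show ?thesis
    proof cases
      case 1
      then show ?thesis using f1 assms rsupp_pm_rsupp by simp
    next
      case 2
      then show ?thesis using fn assms rsupp_pm_rsupp uminus_pm_rsupp by auto
    next
      case 3
      then show ?thesis using * by (simp add: f_def)
    qed
  qed
  have "step\<^sup>*\<^sup>* g (f m)" if "1 \<le> m" "m \<le> n" for m
    using that
  proof (induction m rule: nat_induct_at_least)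
    case base
    then show ?case by (simp add: f1[simplified])
  next
    case (Suc m)
    have "f (Suc m) = f m + (s (Suc m) + k (Suc m))"
      using Suc.hyps by (simp add: f_def add.assoc)
    moreover have "s (Suc m) \<in> pm_rsupp \<union> {0, g0, - g0}" "k (Suc m) \<in> {0, g0, - g0}"
      using * Suc by auto
    ultimately have "step (f m) (f (Suc m))"
      using f_pm[of m] f_pm[of "Suc m"] Suc by (intro stepI[of _ _ "s (Suc m)" "k (Suc m)"]) auto
    then show ?case
      using Suc by auto
  qed
  from this[of n] show "step\<^sup>*\<^sup>* g h \<or> step\<^sup>*\<^sup>* g (- h)"
    using fn * by auto
next
  assume "step\<^sup>*\<^sup>* g h \<or> step\<^sup>*\<^sup>* g (- h)"
  then obtain h' where h': "h' \<in> {h, - h}" "step\<^sup>*\<^sup>* g h'"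
    by blast
  obtain n :: nat and s k where *: "n \<ge> 1"
     "\<forall>i\<in>{1..n}. s i \<in> pm_rsupp \<union> {0, g0, - g0}"
     "\<forall>i\<in>{2..n}. k i \<in> {0, g0, - g0}" "s 1 = g"
     "\<forall>m. 2 \<le> m \<and> m \<le> n \<longrightarrow> s 1 + (\<Sum>i=2..m. s i + k i) \<in> pm_rsupp"
     "s 1 + (\<Sum>i=2..n. s i + k i) = h'"
    using steps_imp_path[OF h'(2) rsupp_pm_rsupp[OF assms(1)]] by blast
  have "\<forall>m. 2 \<le> m \<and> m \<le> n - 1 \<longrightarrow> s 1 + (\<Sum>i=2..m. s i + k i) \<in> pm_rsupp"
    using *(5) by auto
  with *(1-4,6) h'(1) show "connected g h"
    unfolding connected_def by (intro exI[of _ n] exI[of _ s] exI[of _ k] conjI) simp_all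
qed

text \<open>Walks can be reversed and joined, and the negative of a walk is a walk; the last fact
  takes care of the free sign at the end point.\<close>

lemma equiv_conn_rel: "equiv rsupp conn_rel"
proof (rule equivI)
  show "conn_rel \<subseteq> rsupp \<times> rsupp"
    by (auto simp: conn_rel_def)
  show "refl_on rsupp conn_rel"
    by (auto simp: refl_on_def conn_rel_def connected_iff_steps)
  have swap: "step\<^sup>*\<^sup>* b (- a)" if "step\<^sup>*\<^sup>* a (- b)" for a b
    using steps_sym[OF steps_uminus[OF that]] by simp
  show "sym conn_rel"
    by (auto simp: sym_def conn_rel_def connected_iff_steps intro: steps_sym swap)
  show "trans conn_rel"
  proof (rule transI)
    fix a b c
    assume "(a, b) \<in> conn_rel" "(b, c) \<in> conn_rel"
    then have mem: "a \<in> rsupp" "c \<in> rsupp"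
      and ab: "step\<^sup>*\<^sup>* a b \<or> step\<^sup>*\<^sup>* a (- b)" and bc: "step\<^sup>*\<^sup>* b c \<or> step\<^sup>*\<^sup>* b (- c)"
      by (auto simp: conn_rel_def connected_iff_steps)
    \<comment> \<open>If the walk from \<open>a\<close> ends in \<open>- b\<close>, the walk from
      \<open>b\<close> has to be negated before the two can be joined.\<close>
    have "step\<^sup>*\<^sup>* (- b) (- c) \<or> step\<^sup>*\<^sup>* (- b) c"
      using bc steps_uminus[of b c] steps_uminus[of b "- c"] by auto
    then have "step\<^sup>*\<^sup>* a c \<or> step\<^sup>*\<^sup>* a (- c)"
      using ab bc rtranclp_trans[of step] by blast
    with mem show "(a, c) \<in> conn_rel"
      by (simp add: conn_rel_def connected_iff_steps)
  qed
qed

lemma class_subset_rsupp: "C \<in> rsupp // conn_rel \<Longrightarrow> h \<in> C \<Longrightarrow> h \<in> rsupp"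
  using equiv_conn_rel by (metis Union_quotient UnionI)

text \<open>A single move up to sign stays in the class. Later membership claims reduce to this one
  by a choice of \<open>t\<close> and \<open>k\<close>.\<close>

lemma class_step:
  assumes C: "C \<in> rsupp // conn_rel" and h: "h \<in> C" and p: "p \<in> rsupp"
    and t: "t \<in> rsupp \<union> {0, g0, - g0}" and k: "k \<in> {0, g0, - g0}"
    and eq: "p = h + (t + k) \<or> - p = h + (t + k)"
  shows "p \<in> C"
proof -
  have hr: "h \<in> rsupp"
    using C h by (rule class_subset_rsupp)
  have t': "t \<in> pm_rsupp \<union> {0, g0, - g0}"
    using t rsupp_pm_rsupp by blast
  have pm: "h \<in> pm_rsupp" "p \<in> pm_rsupp" "- p \<in> pm_rsupp"
    using hr p rsupp_pm_rsupp uminus_pm_rsupp by auto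
  have "step h p \<or> step h (- p)"
    using eq stepI[OF pm(1,2) t' k] stepI[OF pm(1,3) t' k] by blast
  then have "(h, p) \<in> conn_rel"
    using hr p by (auto simp: conn_rel_def connected_iff_steps)
  then show ?thesis
    using C h equiv_conn_rel by (meson in_quotient_imp_closed)
qed

section \<open>Bilinearity of the two products and spans\<close>

lemma brk_additive:
  "brk x (y + z) = brk x y + brk x z" "brk (x + y) z = brk x z + brk y z"
  "brk x (scale c y) = scale c (brk x y)" "brk (scale c x) y = scale c (brk x y)"
  using brk_linear_right brk_linear_left
  by (auto simp: Vector_Spaces.linear_def module_hom_def module_hom_axioms_def)

lemma mul_additive:
  "mul x (y + z) = mul x y + mul x z" "mul (x + y) z = mul x z + mul y z"
  "mul x (scale c y) = scale c (mul x y)" "mul (scale c x) y = scale c (mul x y)"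
  using mul_linear_right mul_linear_left
  by (auto simp: Vector_Spaces.linear_def module_hom_def module_hom_axioms_def)

lemma brk_zero: "brk x 0 = 0" "brk 0 x = 0"
  using brk_additive(3)[of x 0 0] brk_additive(4)[of 0 0 x] by simp_all

lemma mul_zero: "mul x 0 = 0" "mul 0 x = 0"
  using mul_additive(3)[of x 0 0] mul_additive(4)[of 0 0 x] by simp_all

lemma subspace_vimages:
  assumes "subspace S"
  shows "subspace {y. brk x y \<in> S}" "subspace {x. brk x y \<in> S}"
    "subspace {y. mul x y \<in> S}" "subspace {x. mul x y \<in> S}"
  using assms by (auto simp: subspace_def brk_additive mul_additive brk_zero mul_zero)

lemma span_set_plus: "span A + span B = span (A \<union> B)"
  by (auto simp: span_Un set_plus_def)

lemma set_plus_subset: "subspace S \<Longrightarrow> A \<subseteq> S \<Longrightarrow> B \<subseteq> S \<Longrightarrow> A + B \<subseteq> S"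
  by (blast elim: set_plus_elim intro: subspace_add)

text \<open>Bilinearity is used in one factor at a time: first a generator \<open>a\<close> is fixed
  and \<open>b\<close> varies over its span, then \<open>a\<close> varies.\<close>

lemma span_bilinear_mem:
  assumes "subspace S" "a \<in> span A" "b \<in> span B"
  shows "(\<And>a b. a \<in> A \<Longrightarrow> b \<in> B \<Longrightarrow> brk a b \<in> S) \<Longrightarrow> brk a b \<in> S"
    and "(\<And>a b. a \<in> A \<Longrightarrow> b \<in> B \<Longrightarrow> mul a b \<in> S) \<Longrightarrow> mul a b \<in> S"
proof -
  assume H: "\<And>a b. a \<in> A \<Longrightarrow> b \<in> B \<Longrightarrow> brk a b \<in> S"
  have "span B \<subseteq> {b. brk a b \<in> S}" if "a \<in> A" for a
    using H that by (intro span_minimal subspace_vimages assms) auto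
  then have "span A \<subseteq> {a. brk a b \<in> S}"
    using assms(3) by (intro span_minimal subspace_vimages assms) auto
  then show "brk a b \<in> S"
    using assms(2) by auto
next
  assume H: "\<And>a b. a \<in> A \<Longrightarrow> b \<in> B \<Longrightarrow> mul a b \<in> S"
  have "span B \<subseteq> {b. mul a b \<in> S}" if "a \<in> A" for a
    using H that by (intro span_minimal subspace_vimages assms) auto
  then have "span A \<subseteq> {a. mul a b \<in> S}"
    using assms(3) by (intro span_minimal subspace_vimages assms) auto
  then show "mul a b \<in> S"
    using assms(2) by auto
qed

section \<open>The identities for homogeneous elements, up to scalars\<close>

definition homogeneous :: "'v \<Rightarrow> bool" where
  "homogeneous x \<longleftrightarrow> (\<exists>g. x \<in> P g)"

lemma homogeneous_brk: "homogeneous x \<Longrightarrow> homogeneous y \<Longrightarrow> homogeneous (brk x y)"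
  unfolding homogeneous_def using brk_degree by blast

lemma homogeneous_mul: "homogeneous x \<Longrightarrow> homogeneous y \<Longrightarrow> homogeneous (mul x y)"
  unfolding homogeneous_def using mul_degree by blast

lemma span_homogeneous: "x \<in> span (Collect homogeneous)"
proof -
  obtain f where "\<forall>g. f g \<in> P g" "x = (\<Sum>g | f g \<noteq> 0. f g)"
    using grading[of x] by blast
  then show ?thesis
    by (metis (mono_tags, lifting) homogeneous_def mem_Collect_eq span_base span_sum)
qed

text \<open>Membership in a subspace does not depend on the values of \<open>eps\<close>, so here
  and in the next three lemmas they are hidden behind an unnamed scalar.\<close>

lemma homogeneous_brk_commute:
  assumes "homogeneous x" "homogeneous y"
  obtains c where "brk x y = scale c (brk y x)"
  using assms brk_skew unfolding homogeneous_def by (metis scale_minus_left)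

lemma homogeneous_mul_commute:
  assumes "homogeneous x" "homogeneous y"
  obtains c where "mul x y = scale c (mul y x)"
  using assms mul_comm unfolding homogeneous_def by metis

lemma homogeneous_jacobi:
  assumes "homogeneous x" "homogeneous y" "homogeneous z"
  obtains c where "brk x (brk y z) = brk (brk x y) z + scale c (brk y (brk x z))"
  using assms brk_jacobi unfolding homogeneous_def by metis

lemma homogeneous_leibniz:
  assumes "homogeneous x" "homogeneous y" "homogeneous z"
  obtains c where "brk x (mul y z) = mul (brk x y) z + scale c (mul y (brk x z))"
  using assms leibniz unfolding homogeneous_def by metis

lemma brk_commute_mem:
  assumes "subspace S" "homogeneous x" "homogeneous y" "brk y x \<in> S"
  shows "brk x y \<in> S"
  using assms by (metis homogeneous_brk_commute subspace_scale)

lemma mul_commute_mem: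
  assumes "subspace S" "homogeneous x" "homogeneous y" "mul y x \<in> S"
  shows "mul x y \<in> S"
  using assms by (metis homogeneous_mul_commute subspace_scale)

text \<open>Jacobi and Leibniz are solved for the term in which the product of \<open>x\<close> and
  \<open>y\<close> is one factor. This reduces a product with \<open>z\<close> to products in which
  a single factor meets \<open>z\<close> first.\<close>

lemma product_mem:
  assumes S: "subspace S" and h: "homogeneous x" "homogeneous y" "homogeneous z"
  shows "brk x (brk y z) \<in> S \<Longrightarrow> brk y (brk x z) \<in> S \<Longrightarrow> brk (brk x y) z \<in> S"
    and "brk x (mul y z) \<in> S \<Longrightarrow> mul y (brk x z) \<in> S \<Longrightarrow> mul (brk x y) z \<in> S"
    and "mul x (brk y z) \<in> S \<Longrightarrow> mul y (brk x z) \<in> S \<Longrightarrow> brk (mul x y) z \<in> S"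
proof -
  assume *: "brk x (brk y z) \<in> S" "brk y (brk x z) \<in> S"
  obtain c where "brk x (brk y z) = brk (brk x y) z + scale c (brk y (brk x z))"
    using h by (rule homogeneous_jacobi)
  then have "brk (brk x y) z = brk x (brk y z) - scale c (brk y (brk x z))"
    by simp
  then show "brk (brk x y) z \<in> S"
    using * S by (simp add: subspace_diff subspace_scale)
next
  assume *: "brk x (mul y z) \<in> S" "mul y (brk x z) \<in> S"
  obtain c where "brk x (mul y z) = mul (brk x y) z + scale c (mul y (brk x z))"
    using h by (rule homogeneous_leibniz)
  then have "mul (brk x y) z = brk x (mul y z) - scale c (mul y (brk x z))"
    by simp
  then show "mul (brk x y) z \<in> S"
    using * S by (simp add: subspace_diff subspace_scale)
next
  assume *: "mul x (brk y z) \<in> S" "mul y (brk x z) \<in> S"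
  \<comment> \<open>\<open>leibniz\<close> expands a product only in the second argument of the
    bracket, so \<open>z\<close> moves to the left and the factors are turned around
    afterwards.\<close>
  obtain c where 1: "brk z (mul x y) = mul (brk z x) y + scale c (mul x (brk z y))"
    using h(3,1,2) by (rule homogeneous_leibniz)
  obtain d where "brk z y = scale d (brk y z)"
    using h(3,2) by (rule homogeneous_brk_commute)
  then have 2: "mul x (brk z y) \<in> S"
    using * S by (simp add: mul_additive subspace_scale)
  obtain e where "brk z x = scale e (brk x z)"
    using h(3,1) by (rule homogeneous_brk_commute)
  then have "mul y (brk z x) \<in> S"
    using * S by (simp add: mul_additive subspace_scale)
  then have "mul (brk z x) y \<in> S"
    by (rule mul_commute_mem[OF S homogeneous_brk[OF h(3,1)] h(2)])
  then have "brk z (mul x y) \<in> S"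
    unfolding 1 using 2 S by (simp add: subspace_add subspace_scale)
  then show "brk (mul x y) z \<in> S"
    by (rule brk_commute_mem[OF S homogeneous_mul[OF h(1,2)] h(3)])
qed

section \<open>Mutual annihilation\<close>

definition orth :: "'v \<Rightarrow> 'v \<Rightarrow> bool" where
  "orth x y \<longleftrightarrow> brk x y = 0 \<and> brk y x = 0 \<and> mul x y = 0 \<and> mul y x = 0"

lemma orth_sym: "orth x y \<Longrightarrow> orth y x"
  by (auto simp: orth_def)

lemma homogeneous_orthI:
  assumes "homogeneous x" "homogeneous y" "brk x y = 0" "mul x y = 0"
  shows "orth x y"
  using assms homogeneous_brk_commute[of y x] homogeneous_mul_commute[of y x]
  by (auto simp: orth_def)

text \<open>This is \<open>product_mem\<close> for the zero subspace; associativity settles the one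
  remaining product.\<close>

lemma orth_products:
  assumes h: "homogeneous x" "homogeneous y" "homogeneous z" and o: "orth x z" "orth y z"
  shows "orth (brk x y) z" "orth (mul x y) z"
proof -
  have "brk (brk x y) z \<in> {0}" "mul (brk x y) z \<in> {0}" "brk (mul x y) z \<in> {0}"
    by (rule product_mem[OF subspace_single_0 h]; use o in \<open>simp add: orth_def brk_zero mul_zero\<close>)+
  moreover have "mul (mul x y) z = 0"
    using o by (simp add: orth_def mul_assoc mul_zero)
  ultimately show "orth (brk x y) z" "orth (mul x y) z"
    using h by (auto intro!: homogeneous_orthI homogeneous_brk homogeneous_mul)
qed

section \<open>Homogeneous elements attached to a class, and their degrees\<close>

definition class_hom :: "'g set \<Rightarrow> 'v set" where
  "class_hom C = (\<Union>h\<in>C. P h)"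

text \<open>These generate the space \<open>J\<close> of the overview. Products of any degree are
  taken here, whereas \<open>class_ideal\<close> takes only those of degree 0 or \<plusminus>g0 and
  there admits a factor of degree \<open>- g0\<close>.\<close>

definition class_gen :: "'g set \<Rightarrow> 'v set" where
  "class_gen C = class_hom C \<union> {brk x y | x y. x \<in> class_hom C \<and> y \<in> class_hom C}
     \<union> {mul x y | x y. x \<in> class_hom C \<and> y \<in> class_hom C}"

lemma class_hom_homogeneous: "x \<in> class_hom C \<Longrightarrow> homogeneous x"
  by (auto simp: class_hom_def homogeneous_def)

lemma class_gen_homogeneous: "x \<in> class_gen C \<Longrightarrow> homogeneous x"
  by (auto simp: class_gen_def intro: class_hom_homogeneous homogeneous_brk homogeneous_mul)

lemma class_gen_intros:
  "x \<in> class_hom C \<Longrightarrow> x \<in> span (class_gen C)"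
  "x \<in> class_hom C \<Longrightarrow> y \<in> class_hom C \<Longrightarrow> brk x y \<in> span (class_gen C)"
  "x \<in> class_hom C \<Longrightarrow> y \<in> class_hom C \<Longrightarrow> mul x y \<in> span (class_gen C)"
  by (rule span_base; unfold class_gen_def; blast)+

lemma component_trivial: "g \<notin> rsupp \<Longrightarrow> g \<notin> {0, g0, - g0} \<Longrightarrow> P g = {0}"
  by (auto simp: rsupp_def)

lemma P_class_hom:
  assumes "h \<in> C" "x \<in> P g" "g \<notin> {0, g0, - g0}" "g \<in> rsupp \<Longrightarrow> g \<in> C"
  shows "x \<in> class_hom C"
proof (cases "g \<in> rsupp")
  case True
  then show ?thesis using assms by (auto simp: class_hom_def)
next
  case False
  then have "x = 0"
    using assms component_trivial by auto
  \<comment> \<open>Zero belongs to \<open>class_hom C\<close> because it lies in \<open>P h\<close>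
    for the given member \<open>h\<close> of \<open>C\<close>.\<close>
  then show ?thesis
    using assms(1) comp_subspace subspace_0 by (auto simp: class_hom_def)
qed

text \<open>The degree \<open>p\<close> with the shift \<open>g0\<close> is one admissible
  increment, so a product outside the special degrees 0, \<plusminus>g0 stays in the class.\<close>

lemma brk_class_hom:
  assumes C: "C \<in> rsupp // conn_rel" and h: "h \<in> C" "x \<in> P h"
    and p: "p \<in> rsupp \<union> {0, g0, - g0}" "y \<in> P p" and d: "h + p + g0 \<notin> {0, g0, - g0}"
  shows "brk x y \<in> class_hom C"
proof (rule P_class_hom[OF h(1) brk_degree[OF h(2) p(2)] d])
  assume "h + p + g0 \<in> rsupp"
  then show "h + p + g0 \<in> C"
    by (rule class_step[OF C h(1) _ p(1), of _ g0]) (simp_all add: add.assoc)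
qed

lemma mul_class_hom:
  assumes C: "C \<in> rsupp // conn_rel" and h: "h \<in> C" "x \<in> P h"
    and p: "p \<in> rsupp \<union> {0, g0, - g0}" "y \<in> P p" and d: "h + p \<notin> {0, g0, - g0}"
  shows "mul x y \<in> class_hom C"
proof (rule P_class_hom[OF h(1) mul_degree[OF h(2) p(2)] d])
  assume "h + p \<in> rsupp"
  then show "h + p \<in> C"
    by (rule class_step[OF C h(1) _ p(1), of _ 0]) simp_all
qed

text \<open>From \<open>h\<close>, the increment with \<open>t\<close> equal to \<open>g0\<close> or
  0 and \<open>k\<close> the negative of the special sum leads to \<open>- p\<close>, and the sign
  of the end point is free.\<close>

lemma class_complement:
  assumes C: "C \<in> rsupp // conn_rel" and h: "h \<in> C" and p: "p \<in> rsupp"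
    and eq: "h + p + g0 \<in> {0, g0, - g0} \<or> h + p \<in> {0, g0, - g0}"
  shows "p \<in> C"
  using eq
proof
  assume *: "h + p + g0 \<in> {0, g0, - g0}"
  show ?thesis
    by (rule class_step[OF C h p _ uminus_special[OF *], of g0]) (simp_all add: algebra_simps)
next
  assume *: "h + p \<in> {0, g0, - g0}"
  show ?thesis
    by (rule class_step[OF C h p _ uminus_special[OF *], of 0]) (simp_all add: algebra_simps)
qed

text \<open>If the degree of a product were special, it would connect \<open>h\<close> to
  \<open>p\<close>; if it were in \<open>rsupp\<close>, it would be one move away from both. Classes
  are disjoint, so the component of that degree is zero.\<close>

lemma class_hom_orth:
  assumes C: "C \<in> rsupp // conn_rel" and D: "D \<in> rsupp // conn_rel" and "C \<noteq> D"
    and x: "x \<in> class_hom C" and y: "y \<in> class_hom D"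
  shows "orth x y"
proof -
  obtain h p where h: "h \<in> C" "x \<in> P h" and p: "p \<in> D" "y \<in> P p"
    using x y by (auto simp: class_hom_def)
  have disj: "C \<inter> D = {}"
    using quotient_disj[OF equiv_conn_rel C D] \<open>C \<noteq> D\<close> by blast
  have hr: "h \<in> rsupp" and pr: "p \<in> rsupp"
    using C D h p class_subset_rsupp by auto
  have "p \<notin> C"
    using disj p by auto
  then have d: "h + p + g0 \<notin> {0, g0, - g0}" "h + p \<notin> {0, g0, - g0}"
    using class_complement[OF C h(1) pr] by blast+
  have "h + p + g0 \<notin> rsupp"
  proof
    assume *: "h + p + g0 \<in> rsupp"
    have "h + p + g0 \<in> C"
      by (rule class_step[OF C h(1) *, of p g0]) (use pr in \<open>simp_all add: algebra_simps\<close>)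
    moreover have "h + p + g0 \<in> D"
      by (rule class_step[OF D p(1) *, of h g0]) (use hr in \<open>simp_all add: algebra_simps\<close>)
    ultimately show False using disj by blast
  qed
  then have 1: "brk x y = 0"
    using brk_degree[OF h(2) p(2)] component_trivial d by auto
  have "h + p \<notin> rsupp"
  proof
    assume *: "h + p \<in> rsupp"
    have "h + p \<in> C"
      by (rule class_step[OF C h(1) *, of p 0]) (use pr in \<open>simp_all add: algebra_simps\<close>)
    moreover have "h + p \<in> D"
      by (rule class_step[OF D p(1) *, of h 0]) (use hr in \<open>simp_all add: algebra_simps\<close>)
    ultimately show False using disj by blast
  qed
  then have "mul x y = 0"
    using mul_degree[OF h(2) p(2)] component_trivial d by auto
  with 1 show ?thesis
    using x y class_hom_homogeneous by (intro homogeneous_orthI)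
qed

text \<open>\<open>orth_products\<close> is applied on the left side first, against
  \<open>class_hom D\<close>, and then with the roles exchanged.\<close>

lemma class_gen_orth:
  assumes C: "C \<in> rsupp // conn_rel" and D: "D \<in> rsupp // conn_rel" and ne: "C \<noteq> D"
    and x: "x \<in> class_gen C" and y: "y \<in> class_gen D"
  shows "orth x y"
proof -
  have *: "orth x y" if "x \<in> class_gen C" "y \<in> class_hom D" for x y
    using that class_hom_orth[OF C D ne]
    by (auto simp: class_gen_def intro!: orth_products intro: class_hom_homogeneous)
  have "orth y x"
    using y * x class_gen_homogeneous class_hom_homogeneous
    by (auto simp: class_gen_def[of D] intro!: orth_products intro: orth_sym)
  then show ?thesis
    by (rule orth_sym)
qed

section \<open>Tightness and products that return to a special degree\<close>

definition tight_gen :: "'g \<Rightarrow> 'v set" where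
  "tight_gen \<alpha> =
     {brk a b | a b h p. h \<in> rsupp' \<and> p \<in> rsupp' \<and> h + p + g0 = \<alpha> \<and> a \<in> P h \<and> b \<in> P p} \<union>
     {mul a b | a b h p. h \<in> rsupp' \<and> p \<in> rsupp' \<and> h + p = \<alpha> \<and> a \<in> P h \<and> b \<in> P p}"

lemma tight_subset_span:
  assumes "tight \<alpha>"
  shows "P \<alpha> \<subseteq> span (tight_gen \<alpha>)"
proof -
  have B: "brk_span (P h) (P p) \<subseteq> span (tight_gen \<alpha>)"
    if "h \<in> rsupp'" "p \<in> rsupp'" "p = - h - g0 + \<alpha>" for h p
    unfolding brk_span_def using that
    by (intro span_mono) (fastforce simp: tight_gen_def algebra_simps)
  have M: "mul_span (P h) (P p) \<subseteq> span (tight_gen \<alpha>)"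
    if "h \<in> rsupp'" "p \<in> rsupp'" "p = - h + \<alpha>" for h p
    unfolding mul_span_def using that
    by (intro span_mono) (fastforce simp: tight_gen_def algebra_simps)
  have
    "span (\<Union>{brk_span (P h) (P p) | h p. h \<in> rsupp' \<and> p \<in> rsupp' \<and> p = - h - g0 + \<alpha>})
       \<subseteq> span (tight_gen \<alpha>)"
    "span (\<Union>{mul_span (P k) (P q) | k q. k \<in> rsupp' \<and> q \<in> rsupp' \<and> q = - k + \<alpha>})
       \<subseteq> span (tight_gen \<alpha>)"
    by (intro span_minimal subspace_span; use B M in blast)+
  then show ?thesis
    using assms set_plus_subset[OF subspace_span] unfolding tight_def by simp
qed

text \<open>As \<open>rsupp\<close> already omits 0 and \<plusminus>g0, the excluded degrees are all
  n g0 with |n| \<le> 3, the form in which the case distinctions use them.\<close>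

lemma rsupp'_iff:
  "h \<in> rsupp' \<longleftrightarrow> h \<in> rsupp \<and> h \<notin> {0, g0, - g0, g0 + g0, - (g0 + g0), g0 + g0 + g0, - (g0 + g0 + g0)}"
  by (auto simp: rsupp'_def rsupp_def)

text \<open>The product has special degree, so \<open>class_complement\<close> puts both factors
  into one class.\<close>

lemma tight_gen_cases:
  assumes "w \<in> tight_gen \<alpha>" and \<alpha>: "\<alpha> \<in> {0, g0, - g0}"
  obtains a b h p D where "D \<in> rsupp // conn_rel" "h \<in> D" "p \<in> D" "a \<in> P h" "b \<in> P p"
    "h \<in> rsupp'" "p \<in> rsupp'"
    "w = brk a b \<and> h + p + g0 = \<alpha> \<or> w = mul a b \<and> h + p = \<alpha>"
proof -
  obtain a b h p where *: "h \<in> rsupp'" "p \<in> rsupp'" "a \<in> P h" "b \<in> P p"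
    "w = brk a b \<and> h + p + g0 = \<alpha> \<or> w = mul a b \<and> h + p = \<alpha>"
    using assms unfolding tight_gen_def by blast
  have hp: "h \<in> rsupp" "p \<in> rsupp"
    using * by (auto simp: rsupp'_def)
  let ?D = "conn_rel `` {h}"
  have D: "?D \<in> rsupp // conn_rel" "h \<in> ?D"
    using hp equiv_class_self[OF equiv_conn_rel] by (auto intro: quotientI)
  have "p \<in> ?D"
    using *(5) \<alpha> by (intro class_complement[OF D hp(2)]) auto
  with D * show thesis
    by (intro that[of ?D h p a b])
qed

text \<open>
  Degree bookkeeping: \<open>\<alpha>\<close> is the degree of the factor expanded by tightness, \<open>e\<close> the degree of the
  other factor.
\<close>

lemma bracket_degree:
  assumes \<alpha>: "\<alpha> \<in> {0, g0, - g0}" and d: "\<alpha> + e + g0 \<in> {0, g0, - g0}"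
    and e: "e \<notin> {0, g0, - g0}" and g: "g \<in> rsupp'"
  shows "g + e + g0 \<notin> {0, g0, - g0}"
proof
  assume "g + e + g0 \<in> {0, g0, - g0}"
  moreover define \<beta> \<gamma> where "\<beta> = \<alpha> + e + g0" and "\<gamma> = g + e + g0"
  ultimately have *: "\<beta> \<in> {0, g0, - g0}" "\<gamma> \<in> {0, g0, - g0}"
    "e = \<beta> - \<alpha> - g0" "g = \<gamma> - \<beta> + \<alpha>"
    using d by simp_all
  \<comment> \<open>\<open>g\<close> is a signed sum of three special degrees, hence n g0 with |n|
    \<le> 3, which \<open>rsupp'\<close> excludes.\<close>
  show False
    using \<alpha> *(1,2) e g unfolding *(3,4) rsupp'_iff by auto
qed

lemma product_degree:
  assumes \<alpha>: "\<alpha> \<in> {0, g0, - g0}" and d: "\<alpha> + e \<in> {0, g0, - g0}"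
    and e: "e \<notin> {0, g0, - g0}" and p: "p \<in> rsupp'"
  shows "p + e \<notin> {0, g0, - g0}"
    and "h \<in> rsupp' \<Longrightarrow> h + p + g0 = \<alpha> \<Longrightarrow> h + e + g0 \<notin> {0, g0, - g0}"
proof -
  define \<beta> where "\<beta> = \<alpha> + e"
  have \<beta>: "\<beta> \<in> {0, g0, - g0}" and e_eq: "e = \<beta> - \<alpha>"
    using d by (simp_all add: \<beta>_def)
  show "p + e \<notin> {0, g0, - g0}"
  proof
    define \<gamma> where "\<gamma> = p + e"
    assume "p + e \<in> {0, g0, - g0}"
    then have \<gamma>: "\<gamma> \<in> {0, g0, - g0}" and p_eq: "p = \<gamma> - \<beta> + \<alpha>"
      by (simp_all add: \<gamma>_def e_eq)
    show False
      using \<alpha> \<beta> \<gamma> e p unfolding e_eq p_eq rsupp'_iff by auto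
  qed
  show "h + e + g0 \<notin> {0, g0, - g0}" if h: "h \<in> rsupp'" and hp: "h + p + g0 = \<alpha>"
  proof
    define \<gamma> where "\<gamma> = h + e + g0"
    assume "h + e + g0 \<in> {0, g0, - g0}"
    then have \<gamma>: "\<gamma> \<in> {0, g0, - g0}" and h_eq: "h = \<gamma> - \<beta> + \<alpha> - g0"
      by (simp_all add: \<gamma>_def e_eq)
    have p_eq: "p = \<beta> - \<gamma>"
      using hp unfolding h_eq by (simp add: algebra_simps)
    \<comment> \<open>\<open>h\<close> alone may equal -4 g0, which \<open>rsupp'\<close> does not
      exclude. The partner \<open>p\<close> is a difference of two special degrees, so n g0 with |n|
      \<le> 2, and that is excluded.\<close>
    show False
      using \<alpha> \<beta> \<gamma> e p h unfolding e_eq p_eq h_eq rsupp'_iff by auto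
  qed
qed

text \<open>Factors of \<open>w\<close> from another class annihilate \<open>x\<close>. For factors
  from \<open>C\<close>, the degree lemmas keep the inner products with \<open>x\<close> inside
  \<open>class_hom C\<close>, and the product of \<open>w\<close> with \<open>x\<close> reduces to
  products of two elements of that set.\<close>

lemma tight_gen_products:
  assumes C: "C \<in> rsupp // conn_rel" and w: "w \<in> tight_gen \<alpha>" and x: "x \<in> P e" "e \<in> C"
    and \<alpha>: "\<alpha> \<in> {0, g0, - g0}"
  shows "\<alpha> + e + g0 \<in> {0, g0, - g0} \<Longrightarrow> brk w x \<in> span (class_gen C)"
    and "\<alpha> + e \<in> {0, g0, - g0} \<Longrightarrow> mul w x \<in> span (class_gen C)"
proof -
  let ?J = "span (class_gen C)"
  have sub: "subspace ?J" by simp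
  have er: "e \<in> rsupp"
    using C x class_subset_rsupp by auto
  have e0: "e \<notin> {0, g0, - g0}"
    using er by (auto simp: rsupp_def)
  have xW: "x \<in> class_hom C"
    using x by (auto simp: class_hom_def)
  obtain a b h p D where D: "D \<in> rsupp // conn_rel" and hp: "h \<in> D" "p \<in> D" "a \<in> P h" "b \<in> P p"
    and r: "h \<in> rsupp'" "p \<in> rsupp'"
    and w: "w = brk a b \<and> h + p + g0 = \<alpha> \<or> w = mul a b \<and> h + p = \<alpha>"
    using w \<alpha> by (rule tight_gen_cases)
  have aW: "a \<in> class_hom D" and bW: "b \<in> class_hom D"
    using hp by (auto simp: class_hom_def)
  note hom = class_hom_homogeneous[OF aW] class_hom_homogeneous[OF bW] class_hom_homogeneous[OF xW]
  have "brk w x \<in> ?J \<and> mul w x \<in> ?J" if "D \<noteq> C"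
  proof -
    have "orth a x" "orth b x"
      using class_hom_orth[OF D C that] aW bW xW by auto
    then have "orth w x"
      using w orth_products[OF hom] by auto
    then show ?thesis
      by (simp add: orth_def span_zero)
  qed
  then have reduce: "brk w x \<in> ?J" "mul w x \<in> ?J" if "D \<noteq> C"
    using that by auto
  have er': "e \<in> rsupp \<union> {0, g0, - g0}"
    using er by simp
  have brk_hom: "brk y x \<in> class_hom C" if "D = C" "y \<in> P g" "g \<in> C" "g + e + g0 \<notin> {0, g0, - g0}"
    for y g
    using that x er' by (intro brk_class_hom[OF C])
  have mul_hom: "mul y x \<in> class_hom C" if "D = C" "y \<in> P g" "g \<in> C" "g + e \<notin> {0, g0, - g0}"
    for y g
    using that x er' by (intro mul_class_hom[OF C])
  show "brk w x \<in> ?J" if d: "\<alpha> + e + g0 \<in> {0, g0, - g0}"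
  proof (cases "D = C")
    case True
    have "g + e + g0 \<notin> {0, g0, - g0}" if "g \<in> rsupp'" for g
      using bracket_degree[OF \<alpha> d e0 that] .
    then have "brk a x \<in> class_hom C" "brk b x \<in> class_hom C"
      using True hp r by (auto intro!: brk_hom)
    then show ?thesis
      using w aW bW True
      by (auto intro!: product_mem[OF sub hom] intro: class_gen_intros)
  qed (rule reduce)
  show "mul w x \<in> ?J" if d: "\<alpha> + e \<in> {0, g0, - g0}"
  proof (cases "D = C")
    case True
    have "p + e \<notin> {0, g0, - g0}"
      using product_degree(1)[OF \<alpha> d e0 r(2)] .
    then have bx: "mul b x \<in> class_hom C"
      using True hp by (auto intro!: mul_hom)
    from w show ?thesis
    proof (elim disjE conjE)
      assume w: "w = brk a b" "h + p + g0 = \<alpha>"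
      \<comment> \<open>Leibniz produces \<open>brk a (mul b x)\<close> and
        \<open>mul b (brk a x)\<close>, so the bracket of \<open>a\<close> with \<open>x\<close> has
        to avoid the special degrees too.\<close>
      have "h + e + g0 \<notin> {0, g0, - g0}"
        using product_degree(2)[OF \<alpha> d e0 r(2,1) w(2)] .
      then have "brk a x \<in> class_hom C"
        using True hp by (auto intro!: brk_hom)
      then show ?thesis
        unfolding w using bx aW bW True
        by (auto intro!: product_mem[OF sub hom] intro: class_gen_intros)
    next
      assume "w = mul a b"
      then show ?thesis
        using bx aW True by (auto simp: mul_assoc intro: class_gen_intros)
    qed
  qed (rule reduce)
qed

section \<open>Absorption of arbitrary factors\<close>

lemma component_products:
  assumes C: "C \<in> rsupp // conn_rel" and t: "\<And>\<alpha>. \<alpha> \<in> {0, g0, - g0} \<Longrightarrow> tight \<alpha>"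
    and w: "w \<in> P g" and x: "x \<in> class_hom C"
  shows "brk x w \<in> span (class_gen C)" "mul x w \<in> span (class_gen C)"
proof -
  let ?J = "span (class_gen C)"
  have sub: "subspace ?J" by simp
  obtain e where e: "x \<in> P e" "e \<in> C"
    using x by (auto simp: class_hom_def)
  have hom: "homogeneous x" "homogeneous w"
    using w e by (auto simp: homogeneous_def)
  consider (supp) "g \<in> rsupp" | (spec) "g \<in> {0, g0, - g0}" | (triv) "w = 0"
    using component_trivial[of g] w by auto
  then have "brk x w \<in> ?J \<and> mul x w \<in> ?J"
  proof cases
    case supp
    let ?D = "conn_rel `` {g}"
    have D: "?D \<in> rsupp // conn_rel" "g \<in> ?D"
      using supp equiv_class_self[OF equiv_conn_rel] by (auto intro: quotientI)
    then have wW: "w \<in> class_hom ?D"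
      using w by (auto simp: class_hom_def)
    show ?thesis
    proof (cases "?D = C")
      case True
      then show ?thesis using wW x by (auto intro: class_gen_intros)
    next
      case False
      then have "orth w x"
        using class_hom_orth[OF D(1) C] wW x by auto
      then show ?thesis by (simp add: orth_def span_zero)
    qed
  next
    case spec
    have wg: "w \<in> span (tight_gen g)"
      using w tight_subset_span[OF t[OF spec]] by auto
    have "brk x w \<in> ?J"
    proof (cases "e + g + g0 \<in> {0, g0, - g0}")
      case True
      \<comment> \<open>Tightness expands \<open>w\<close>, the factor of special degree; it stands
        on the left here and skew-symmetry restores the order.\<close>
      then have "span (tight_gen g) \<subseteq> {w. brk w x \<in> ?J}"
        using tight_gen_products(1)[OF C _ e spec]
        by (intro span_minimal subspace_vimages sub) (auto simp: ac_simps)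
      then show ?thesis
        using wg brk_commute_mem[OF sub hom] by blast
    next
      case False
      then show ?thesis
        using spec by (intro class_gen_intros(1) brk_class_hom[OF C e(2,1) _ w]) auto
    qed
    moreover have "mul x w \<in> ?J"
    proof (cases "e + g \<in> {0, g0, - g0}")
      case True
      then have "span (tight_gen g) \<subseteq> {w. mul w x \<in> ?J}"
        using tight_gen_products(2)[OF C _ e spec]
        by (intro span_minimal subspace_vimages sub) (auto simp: ac_simps)
      then show ?thesis
        using wg mul_commute_mem[OF sub hom] by blast
    next
      case False
      then show ?thesis
        using spec by (intro class_gen_intros(1) mul_class_hom[OF C e(2,1) _ w]) auto
    qed
    ultimately show ?thesis ..
  next
    case triv
    then show ?thesis by (simp add: brk_zero mul_zero span_zero)
  qed
  then show "brk x w \<in> ?J" "mul x w \<in> ?J" by auto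
qed

text \<open>After reduction to homogeneous factors, a generator that is itself a product is treated
  by Jacobi, Leibniz and associativity.\<close>

lemma span_class_gen_products:
  assumes C: "C \<in> rsupp // conn_rel" and t: "\<And>\<alpha>. \<alpha> \<in> {0, g0, - g0} \<Longrightarrow> tight \<alpha>"
    and x: "x \<in> span (class_gen C)"
  shows "brk x w \<in> span (class_gen C)" "brk w x \<in> span (class_gen C)"
    "mul x w \<in> span (class_gen C)" "mul w x \<in> span (class_gen C)"
proof -
  let ?J = "span (class_gen C)"
  have sub: "subspace ?J" by simp
  have W: "brk x w \<in> ?J" "mul x w \<in> ?J" if "x \<in> class_hom C" "homogeneous w" for x w
    using that component_products[OF C t] by (auto simp: homogeneous_def)
  have gen: "brk x w \<in> ?J \<and> mul x w \<in> ?J" if x: "x \<in> class_gen C" and w: "homogeneous w" for x w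
  proof -
    consider "x \<in> class_hom C"
      | (prod) a b where "a \<in> class_hom C" "b \<in> class_hom C" "x = brk a b \<or> x = mul a b"
      using x by (auto simp: class_gen_def)
    then show ?thesis
    proof cases
      case prod
      note hom = class_hom_homogeneous[OF prod(1)] class_hom_homogeneous[OF prod(2)] w
      \<comment> \<open>The inner products with \<open>w\<close> enter only as arbitrary homogeneous
        elements; the outer factor in \<open>class_hom C\<close> does the work.\<close>
      have "brk a (brk b w) \<in> ?J" "brk b (brk a w) \<in> ?J" "brk a (mul b w) \<in> ?J"
        "mul b (brk a w) \<in> ?J" "mul a (brk b w) \<in> ?J" "mul a (mul b w) \<in> ?J"
        using prod hom by (auto intro!: W homogeneous_brk homogeneous_mul)
      then show ?thesis
        using prod(3) product_mem[OF sub hom] by (auto simp: mul_assoc)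
    qed (use W w in auto)
  qed
  have gen': "brk w x \<in> ?J \<and> mul w x \<in> ?J" if x: "x \<in> class_gen C" and w: "homogeneous w" for x w
    using gen[OF that] class_gen_homogeneous[OF x] w brk_commute_mem[OF sub] mul_commute_mem[OF sub]
    by blast
  show "brk x w \<in> ?J" "mul x w \<in> ?J"
    using gen by (auto intro: span_bilinear_mem[OF sub x span_homogeneous])
  show "brk w x \<in> ?J" "mul w x \<in> ?J"
    using gen' by (auto intro: span_bilinear_mem[OF sub span_homogeneous x])
qed

section \<open>The ideals of the classes and the decomposition\<close>

text \<open>One inclusion is absorption. For the other, a product of two elements of
  \<open>class_hom C\<close> either has special degree and occurs in \<open>class_part\<close>, or
  lies in \<open>class_hom C\<close> again.\<close>

lemma class_ideal_eq:
  assumes C: "C \<in> rsupp // conn_rel" and t: "\<And>\<alpha>. \<alpha> \<in> {0, g0, - g0} \<Longrightarrow> tight \<alpha>"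
  shows "class_ideal C = span (class_gen C)"
proof
  let ?J = "span (class_gen C)"
  have P: "P h \<subseteq> ?J" if "h \<in> C" for h
    using that by (auto simp: class_hom_def intro!: class_gen_intros)
  \<comment> \<open>\<open>A\<close> is arbitrary, which covers the factor of degree
    \<open>- g0\<close> in \<open>class_part\<close>.\<close>
  have B: "brk_span (P h) A \<subseteq> ?J" and M: "mul_span (P h) A \<subseteq> ?J" if "h \<in> C" for h A
    unfolding brk_span_def mul_span_def using P[OF that]
    by (intro span_minimal; auto intro: span_class_gen_products[OF C t])+
  have "class_part \<alpha> C \<subseteq> ?J" for \<alpha>
    unfolding class_part_def
    by (intro set_plus_subset span_minimal subspace_span; use B M in blast)
  then have "span (\<Union>\<alpha>\<in>{0, g0, - g0}. class_part \<alpha> C) \<subseteq> ?J"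
    by (intro span_minimal) auto
  moreover have "class_space C \<subseteq> ?J"
    unfolding class_space_def using P by (intro span_minimal) auto
  ultimately show "class_ideal C \<subseteq> ?J"
    unfolding class_ideal_def by (intro set_plus_subset subspace_span)
next
  let ?A = "span (\<Union>\<alpha>\<in>{0, g0, - g0}. class_part \<alpha> C)"
  have A: "?A \<subseteq> class_ideal C"
    unfolding class_ideal_def class_space_def using set_plus_intro[OF _ span_zero] by fastforce
  have V: "class_space C \<subseteq> class_ideal C"
    unfolding class_ideal_def using set_plus_intro[OF span_zero] by fastforce
  have WV: "class_hom C \<subseteq> class_space C"
    unfolding class_space_def class_hom_def by (auto intro: span_base)
  have brk_part: "brk x y \<in> class_part \<alpha> C"
    if "x \<in> P h" "y \<in> P p" "h \<in> C" "p \<in> C" "h + p + g0 = \<alpha>" for x y h p \<alpha>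
  proof -
    have "brk x y \<in> brk_span (P h) (P p)"
      unfolding brk_span_def using that by (auto intro: span_base)
    moreover have "p \<in> rsupp" "p = - h - g0 + \<alpha>"
      using that class_subset_rsupp[OF C] by (auto simp: algebra_simps)
    ultimately have "brk x y \<in> span (\<Union>{brk_span (P h) (P p) | h p.
        h \<in> C \<and> p \<in> rsupp \<and> p = - h - g0 + \<alpha>})"
      using that by (intro span_base) blast
    then show ?thesis
      unfolding class_part_def using set_plus_intro[OF _ span_zero] by fastforce
  qed
  have mul_part: "mul x y \<in> class_part \<alpha> C"
    if "x \<in> P h" "y \<in> P p" "h \<in> C" "p \<in> C" "h + p = \<alpha>" for x y h p \<alpha>
  proof -
    have "mul x y \<in> mul_span (P h) (P p)"
      unfolding mul_span_def using that by (auto intro: span_base)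
    moreover have "p \<in> rsupp \<union> {- g0}" "p = - h + \<alpha>"
      using that class_subset_rsupp[OF C] by (auto simp: algebra_simps)
    ultimately have "mul x y \<in> span (\<Union>{mul_span (P k) (P q) | k q.
        k \<in> C \<and> q \<in> rsupp \<union> {- g0} \<and> q = - k + \<alpha>})"
      using that by (intro span_base) blast
    then show ?thesis
      unfolding class_part_def using set_plus_intro[OF span_zero] by fastforce
  qed
  have prods: "brk x y \<in> class_ideal C \<and> mul x y \<in> class_ideal C"
    if xy: "x \<in> class_hom C" "y \<in> class_hom C" for x y
  proof -
    obtain h p where h: "h \<in> C" "x \<in> P h" and p: "p \<in> C" "y \<in> P p"
      using xy by (auto simp: class_hom_def)
    have pr: "p \<in> rsupp \<union> {0, g0, - g0}"
      using p class_subset_rsupp[OF C] by auto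
    have "brk x y \<in> class_ideal C"
    proof (cases "h + p + g0 \<in> {0, g0, - g0}")
      case True
      have "brk x y \<in> ?A"
        using brk_part[OF h(2) p(2) h(1) p(1) refl] True by (intro span_base) blast
      then show ?thesis using A by auto
    next
      case False
      then show ?thesis
        using brk_class_hom[OF C h pr p(2)] WV V by auto
    qed
    moreover have "mul x y \<in> class_ideal C"
    proof (cases "h + p \<in> {0, g0, - g0}")
      case True
      have "mul x y \<in> ?A"
        using mul_part[OF h(2) p(2) h(1) p(1) refl] True by (intro span_base) blast
      then show ?thesis using A by auto
    next
      case False
      then show ?thesis
        using mul_class_hom[OF C h pr p(2)] WV V by auto
    qed
    ultimately show ?thesis ..
  qed
  have "subspace (class_ideal C)"
    unfolding class_ideal_def class_space_def span_set_plus by (rule subspace_span)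
  moreover have "class_gen C \<subseteq> class_ideal C"
    using prods WV V by (auto simp: class_gen_def)
  ultimately show "span (class_gen C) \<subseteq> class_ideal C"
    by (intro span_minimal)
qed

lemma is_ideal_class_ideal:
  assumes C: "C \<in> rsupp // conn_rel" and t: "\<And>\<alpha>. \<alpha> \<in> {0, g0, - g0} \<Longrightarrow> tight \<alpha>"
  shows "is_ideal (class_ideal C)"
proof -
  let ?J = "span (class_gen C)"
  note prods = span_class_gen_products[OF C t]
  \<comment> \<open>The generators are homogeneous, so their span is graded.\<close>
  have "class_gen C \<subseteq> (\<Union>g. ?J \<inter> P g)"
    using class_gen_homogeneous by (auto simp: homogeneous_def intro: span_base)
  then have "?J \<subseteq> span (\<Union>g. ?J \<inter> P g)"
    by (rule span_mono)
  moreover have "span (\<Union>g. ?J \<inter> P g) \<subseteq> ?J"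
    by (intro span_minimal) auto
  ultimately have "graded_subspace ?J"
    unfolding graded_subspace_def by simp
  moreover have "brk_span ?J A \<subseteq> ?J" "brk_span A ?J \<subseteq> ?J" "mul_span ?J A \<subseteq> ?J" "mul_span A ?J \<subseteq> ?J"
    for A
    unfolding brk_span_def mul_span_def by (intro span_minimal; auto intro: prods)+
  ultimately have "is_ideal ?J"
    unfolding is_ideal_def subalgebra_def
    by (intro conjI set_plus_subset subspace_span)
  then show ?thesis
    using class_ideal_eq[OF C t] by simp
qed

lemma class_ideal_orth:
  assumes C: "C \<in> rsupp // conn_rel" and D: "D \<in> rsupp // conn_rel" and "C \<noteq> D"
    and t: "\<And>\<alpha>. \<alpha> \<in> {0, g0, - g0} \<Longrightarrow> tight \<alpha>"
  shows "brk_span (class_ideal C) (class_ideal D) + mul_span (class_ideal C) (class_ideal D) = {0}"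
proof -
  have eqs: "class_ideal C = span (class_gen C)" "class_ideal D = span (class_gen D)"
    using class_ideal_eq C D t by simp_all
  have gen: "brk a b \<in> {0}" "mul a b \<in> {0}" if "a \<in> class_gen C" "b \<in> class_gen D" for a b
    using class_gen_orth[OF C D \<open>C \<noteq> D\<close> that] by (simp_all add: orth_def)
  have "brk x y \<in> {0}" "mul x y \<in> {0}" if xy: "x \<in> class_ideal C" "y \<in> class_ideal D" for x y
    using span_bilinear_mem[OF subspace_single_0 xy[unfolded eqs]] gen by blast+
  then have "brk_span (class_ideal C) (class_ideal D) \<subseteq> {0}"
    "mul_span (class_ideal C) (class_ideal D) \<subseteq> {0}"
    unfolding brk_span_def mul_span_def by (intro span_minimal; auto)+
  moreover have "0 \<in> brk_span (class_ideal C) (class_ideal D)"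
    "0 \<in> mul_span (class_ideal C) (class_ideal D)"
    unfolding brk_span_def mul_span_def by (rule span_zero)+
  ultimately have "brk_span (class_ideal C) (class_ideal D) = {0}"
    "mul_span (class_ideal C) (class_ideal D) = {0}"
    by blast+
  then show ?thesis
    by (simp add: set_plus_def)
qed

text \<open>A component with degree in \<open>rsupp\<close> lies in the ideal of its class. A
  special component is spanned, by tightness, by products whose two factors share a class.\<close>

lemma span_class_ideals:
  assumes t: "\<And>\<alpha>. \<alpha> \<in> {0, g0, - g0} \<Longrightarrow> tight \<alpha>"
  shows "span (\<Union>C\<in>rsupp // conn_rel. class_ideal C) = UNIV" (is "?S = _")
proof -
  have J: "span (class_gen C) \<subseteq> ?S" if "C \<in> rsupp // conn_rel" for C
    using class_ideal_eq[OF that t] that by (auto intro: span_base)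
  have "P g \<subseteq> ?S" for g
  proof -
    consider "g \<in> rsupp" | (spec) "g \<in> {0, g0, - g0}" | "P g = {0}"
      using component_trivial[of g] by auto
    then show ?thesis
    proof cases
      case 1
      let ?D = "conn_rel `` {g}"
      have "?D \<in> rsupp // conn_rel" "g \<in> ?D"
        using 1 equiv_class_self[OF equiv_conn_rel] by (auto intro: quotientI)
      then show ?thesis
        using J[of ?D] class_gen_intros(1)[of _ ?D] by (auto simp: class_hom_def)
    next
      case spec
      have "tight_gen g \<subseteq> ?S"
      proof
        fix w assume "w \<in> tight_gen g"
        then obtain a b h p D where *: "D \<in> rsupp // conn_rel" "h \<in> D" "p \<in> D" "a \<in> P h" "b \<in> P p"
          "w = brk a b \<and> h + p + g0 = g \<or> w = mul a b \<and> h + p = g"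
          by (rule tight_gen_cases[OF _ spec])
        have "a \<in> class_hom D" "b \<in> class_hom D"
          using * by (auto simp: class_hom_def)
        then have "w \<in> span (class_gen D)"
          using *(6) class_gen_intros by auto
        then show "w \<in> ?S"
          using J[OF *(1)] by auto
      qed
      then have "span (tight_gen g) \<subseteq> ?S"
        by (intro span_minimal) auto
      then show ?thesis
        using tight_subset_span[OF t[OF spec]] by auto
    qed (simp add: span_zero)
  qed
  then have "span (Collect homogeneous) \<subseteq> ?S"
    by (intro span_minimal subspace_span) (use homogeneous_def in blast)
  then show ?thesis
    using span_homogeneous by auto
qed

end

theorem theorem2:
  fixes scale :: "'k::field \<Rightarrow> 'v::ab_group_add \<Rightarrow> 'v"
    and eps :: "'g::ab_group_add \<Rightarrow> 'g \<Rightarrow> 'k"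
    and g0 :: 'g
    and P :: "'g \<Rightarrow> 'v set"
    and brk mul :: "'v \<Rightarrow> 'v \<Rightarrow> 'v"
  assumes two_torsion_free: "\<And>x::'g. x + x = 0 \<Longrightarrow> x = 0"
    and algebra: "poisson_color_algebra scale eps g0 P brk mul"
    and tight: "\<And>\<alpha>. \<alpha> \<in> {0, g0, - g0} \<Longrightarrow> poisson_color_algebra.tight scale g0 P brk mul \<alpha>"
  shows "let classes = poisson_color_algebra.rsupp g0 P // poisson_color_algebra.conn_rel g0 P;
             I = poisson_color_algebra.class_ideal scale g0 P brk mul
         in UNIV = module.span scale (\<Union>C\<in>classes. I C) \<and>
            (\<forall>C\<in>classes. poisson_color_algebra.is_ideal scale P brk mul (I C)) \<and>
            (\<forall>C\<in>classes. \<forall>D\<in>classes. C \<noteq> D \<longrightarrow>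
               poisson_color_algebra.brk_span scale brk (I C) (I D)
               + poisson_color_algebra.mul_span scale mul (I C) (I D) = {0})"
proof -
  interpret poisson_color_algebra scale eps g0 P brk mul
    by (fact algebra)
  show ?thesis
    unfolding Let_def
    using span_class_ideals[OF tight] is_ideal_class_ideal[OF _ tight] class_ideal_orth[OF _ _ _ tight]
    by simp
qed

end
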